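(* Let $A\subset\mathbb{R}^n$, let $x\in\overline A$, let $v_1,\dots,v_k\in S^{n-1}$ be linearly independent, let $d_1,\dots,d_k\in[0,1]$, and assume that $A$ admits a product-grid realization of type $(v_i,d_i)_{i=1}^k$ at $x$. Then \[ \dim_{\mathrm{Pbox}}\{x\}_A\ge\sum_{i=1}^k d_i. \]
   Context: A set is $\delta$-separated if any two of its distinct points are at distance at least $\delta$. Product-grid realization: $A$ admits a product-grid realization of type $(v_i,d_i)_{i=1}^k$ at $x$ if there exist constants $C\ge1$ and $c>0$ such that, for every $\rho_0>0$, every $0<\rho<\rho_0$, and every $\eta>0$, there are scales $\varepsilon_m\downarrow0$ with $0<\varepsilon_m<\rho$, and finite sets $P_{i,m}\subset[-\rho,\rho]$, $i=1,\dots,k$, satisfying $\#P_{i,m}\ge(\rho/\varepsilon_m)^{d_i-\eta}$ for $i=1,\dots,k$, and such that the grid $G_m:=\{x+\sum_{i=1}^k t_iv_i:t_i\in P_{i,m}\}$ is contained in $A\cap B(x,C\rho)$ and is $c\varepsilon_m$-separated. Point-extended box dimension: for bounded $E\subset\mathbb{R}^n$, $N_\varepsilon(E)$ is the minimal number of sets of diameter at most $\varepsilon$ covering $E$ and $\overline{\dim}_B(E):=\limsup_{\varepsilon\to0}\frac{\ln N_\varepsilon(E)}{\ln(1/\varepsilon)}$. For $x\in\overline A$, $\dim_{\mathrm{Pbox}}\{x\}_A:=\inf_{r>0}\overline{\dim}_B(A\cap B(x,r))$. *)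

theory Defs
  imports "HOL-Analysis.Analysis"
begin

definition separated :: "real \<Rightarrow> 'a::metric_space set \<Rightarrow> bool" where
  "separated \<delta> S \<longleftrightarrow> (\<forall>p\<in>S. \<forall>q\<in>S. p \<noteq> q \<longrightarrow> \<delta> \<le> dist p q)"

text \<open>The conjunct \<^term>\<open>bounded S\<close> is needed because the library's \<^const>\<open>diameter\<close> is a
  real-valued supremum and carries no information on unbounded sets.\<close>

definition covering_number :: "real \<Rightarrow> 'a::metric_space set \<Rightarrow> nat" where
  "covering_number \<epsilon> E =
     (LEAST N. \<exists>F. finite F \<and> card F = N \<and> (\<forall>S\<in>F. bounded S \<and> diameter S \<le> \<epsilon>) \<and> E \<subseteq> \<Union>F)"

text \<open>Meaningful for bounded nonempty \<open>E\<close>; for \<open>E = {}\<close> the convention \<open>ln 0 = 0\<close>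
  yields the value 0.\<close>

definition upper_box_dim :: "'a::metric_space set \<Rightarrow> ereal" where
  "upper_box_dim E =
     Limsup (at_right 0) (\<lambda>\<epsilon>::real. ereal (ln (real (covering_number \<epsilon> E)) / ln (1 / \<epsilon>)))"

definition pbox_dim :: "'a::metric_space set \<Rightarrow> 'a \<Rightarrow> ereal" where
  "pbox_dim A x = (INF r\<in>{0<..}. upper_box_dim (A \<inter> ball x r))"

definition grid :: "'a::real_vector \<Rightarrow> nat \<Rightarrow> (nat \<Rightarrow> 'a) \<Rightarrow> (nat \<Rightarrow> real set) \<Rightarrow> 'a set" where
  "grid x k v P = {x + (\<Sum>i=1..k. t i *\<^sub>R v i) | t. \<forall>i\<in>{1..k}. t i \<in> P i}"

definition product_grid_realization ::
  "'a::real_normed_vector set \<Rightarrow> 'a \<Rightarrow> nat \<Rightarrow> (nat \<Rightarrow> 'a) \<Rightarrow> (nat \<Rightarrow> real) \<Rightarrow> bool" where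
  "product_grid_realization A x k v d \<longleftrightarrow>
     (\<exists>C\<ge>1. \<exists>c>0. \<forall>\<rho>\<^sub>0>0. \<forall>\<rho>. 0 < \<rho> \<and> \<rho> < \<rho>\<^sub>0 \<longrightarrow> (\<forall>\<eta>>0.
        \<exists>(\<epsilon> :: nat \<Rightarrow> real) (P :: nat \<Rightarrow> nat \<Rightarrow> real set).
          decseq \<epsilon> \<and> \<epsilon> \<longlonglongrightarrow> 0 \<and>
          (\<forall>m. 0 < \<epsilon> m \<and> \<epsilon> m < \<rho> \<and>
               (\<forall>i\<in>{1..k}. finite (P i m) \<and> P i m \<subseteq> {-\<rho>..\<rho>} \<and>
                            real (card (P i m)) \<ge> (\<rho> / \<epsilon> m) powr (d i - \<eta>)) \<and>
               grid x k v (\<lambda>i. P i m) \<subseteq> A \<inter> ball x (C * \<rho>) \<and>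
               separated (c * \<epsilon> m) (grid x k v (\<lambda>i. P i m)))))"

end

theory Submission
  imports Defs
begin

text \<open>A grid that is \<open>c\<epsilon>\<close>-separated meets each set of diameter at most \<open>c\<epsilon>/2\<close> in at most one
  point, so the covering number at scale \<open>c\<epsilon>/2\<close> is at least the number of grid points. By linear
  independence this number is the product of the cardinalities of the factors, hence at least
  \<open>(\<rho>/\<epsilon>)\<close> to the power \<open>\<Sum>d\<^sub>i - k\<eta>\<close>. Taking logarithms and letting \<open>\<epsilon> \<rightarrow> 0\<close>, then \<open>\<eta> \<rightarrow> 0\<close>, gives
  the bound for every neighbourhood of \<open>x\<close>.\<close>

text \<open>The \<open>LEAST\<close> in \<open>covering_number\<close> is attained only once some
  finite cover exists. Total boundedness of the compact closure supplies one by balls of radius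
  \<open>\<epsilon>/2\<close>, whose diameter is at most \<open>\<epsilon>\<close>.\<close>

lemma covering_number_cover:
  fixes E :: "'a::heine_borel set"
  assumes "bounded E" "0 < \<epsilon>"
  obtains F where "finite F" "card F = covering_number \<epsilon> E"
    "\<And>S. S \<in> F \<Longrightarrow> bounded S \<and> diameter S \<le> \<epsilon>" "E \<subseteq> \<Union>F"
proof -
  have "compact (closure E)"
    using assms by (simp add: compact_closure)
  then obtain K where K: "finite K" "closure E \<subseteq> (\<Union>x\<in>K. ball x (\<epsilon>/2))"
    using assms(2) unfolding compact_eq_totally_bounded by (meson half_gt_zero)
  have "dist y z \<le> \<epsilon>" if "y \<in> ball x (\<epsilon>/2)" "z \<in> ball x (\<epsilon>/2)" for x y z :: 'a
    using that dist_triangle_half_r[of x y \<epsilon> z] by simp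
  then have "diameter (ball x (\<epsilon>/2)) \<le> \<epsilon>" for x :: 'a
    unfolding diameter_def using assms(2) by (auto intro!: cSUP_least)
  then have "\<exists>F. finite F \<and> card F = card ((\<lambda>x. ball x (\<epsilon>/2)) ` K)
      \<and> (\<forall>S\<in>F. bounded S \<and> diameter S \<le> \<epsilon>) \<and> E \<subseteq> \<Union>F"
    using K closure_subset[of E]
    by (intro exI[of _ "(\<lambda>x. ball x (\<epsilon>/2)) ` K"]) auto
  then have "\<exists>F. finite F \<and> card F = covering_number \<epsilon> E
      \<and> (\<forall>S\<in>F. bounded S \<and> diameter S \<le> \<epsilon>) \<and> E \<subseteq> \<Union>F"
    unfolding covering_number_def by (rule LeastI)
  then show thesis using that by blast
qed

text \<open>Picking for each point of \<open>G\<close> a member of a minimal cover that contains it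
  is injective: two distinct points in one member would be at distance at most
  \<open>\<epsilon> < \<delta>\<close>.\<close>

lemma card_separated_le_covering_number:
  fixes E :: "'a::heine_borel set"
  assumes "bounded E" "0 < \<epsilon>" "\<epsilon> < \<delta>" "G \<subseteq> E" "separated \<delta> G"
  shows "card G \<le> covering_number \<epsilon> E"
proof -
  obtain F where F: "finite F" "card F = covering_number \<epsilon> E"
    "\<And>S. S \<in> F \<Longrightarrow> bounded S \<and> diameter S \<le> \<epsilon>" "E \<subseteq> \<Union>F"
    using covering_number_cover assms(1,2) by blast
  have "\<forall>p\<in>G. \<exists>S\<in>F. p \<in> S" using F(4) assms(4) by blast
  then obtain f where f: "\<And>p. p \<in> G \<Longrightarrow> f p \<in> F \<and> p \<in> f p" by metis
  have "inj_on f G"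
  proof (rule inj_onI, rule ccontr)
    fix p q assume *: "p \<in> G" "q \<in> G" "f p = f q" "p \<noteq> q"
    then have "dist p q \<le> diameter (f p)"
      using f F(3) by (metis diameter_bounded_bound)
    moreover have "\<delta> \<le> dist p q"
      using * assms(5) by (auto simp: separated_def)
    ultimately show False using F(3)[of "f p"] f[of p] * assms(3) by auto
  qed
  then show ?thesis
    using f F(1,2) card_inj_on_le[of f G F] by auto
qed

lemma card_grid:
  fixes v :: "nat \<Rightarrow> 'a::real_vector"
  assumes inj: "inj_on v {1..k}" and ind: "independent (v ` {1..k})"
  shows "card (grid x k v P) = (\<Prod>i=1..k. card (P i))"
proof -
  let ?g = "\<lambda>t. x + (\<Sum>i=1..k. t i *\<^sub>R v i)"
  \<comment> \<open>In \<open>grid\<close> the function \<open>t\<close> is arbitrary outside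
    \<open>{1..k}\<close>. Extensional functions give each coefficient tuple a single
    representative, so that injectivity of \<open>?g\<close> can hold.\<close>
  have "grid x k v P = ?g ` Pi\<^sub>E {1..k} P"
  proof
    show "grid x k v P \<subseteq> ?g ` Pi\<^sub>E {1..k} P"
    proof
      fix y assume "y \<in> grid x k v P"
      then obtain t where t: "y = ?g t" "\<forall>i\<in>{1..k}. t i \<in> P i"
        unfolding grid_def by blast
      then have "y = ?g (restrict t {1..k})" "restrict t {1..k} \<in> Pi\<^sub>E {1..k} P"
        by (auto intro!: sum.cong)
      then show "y \<in> ?g ` Pi\<^sub>E {1..k} P" by blast
    qed
  qed (auto simp: grid_def PiE_iff)
  moreover have "inj_on ?g (Pi\<^sub>E {1..k} P)"
  proof (rule inj_onI)
    fix s t assume s: "s \<in> Pi\<^sub>E {1..k} P" and t: "t \<in> Pi\<^sub>E {1..k} P" and eq: "?g s = ?g t"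
    \<comment> \<open>Independence speaks of a set of vectors, so the coefficient differences are
      moved from indices to vectors through the inverse of \<open>v\<close>.\<close>
    let ?u = "\<lambda>w. s (inv_into {1..k} v w) - t (inv_into {1..k} v w)"
    have "(\<Sum>w\<in>v ` {1..k}. ?u w *\<^sub>R w) = (\<Sum>i=1..k. (s i - t i) *\<^sub>R v i)"
      using inj by (simp add: sum.reindex)
    also have "\<dots> = 0" using eq by (simp add: scaleR_left_diff_distrib sum_subtractf)
    finally have "\<And>i. i \<in> {1..k} \<Longrightarrow> ?u (v i) = 0"
      using independentD[OF ind, of "v ` {1..k}" ?u] by blast
    then show "s = t" using inj by (intro PiE_ext[OF s t]) simp
  qed
  ultimately show ?thesis by (simp add: card_image card_PiE)
qed

text \<open>Every set that is eventual for \<open>F\<close> eventually contains \<open>g m\<close>,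
  so its supremum dominates the limit of \<open>h\<close>. A single sequence of scales can thus
  bound a limsup over all scales from below.\<close>

lemma le_Limsup_along_filterlim:
  fixes f :: "'a \<Rightarrow> 'b::{complete_linorder,linorder_topology}"
  assumes "filterlim g F G" "G \<noteq> bot" "(h \<longlongrightarrow> l) G" "eventually (\<lambda>m. h m \<le> f (g m)) G"
  shows "l \<le> Limsup F f"
  unfolding Limsup_def
proof (rule INF_greatest)
  fix P assume "P \<in> {P. eventually P F}"
  then have "eventually (\<lambda>m. P (g m)) G"
    using assms(1) by (simp add: filterlim_iff)
  with assms(4) have "eventually (\<lambda>m. h m \<le> (SUP x\<in>{x. P x}. f x)) G"
    by eventually_elim (auto intro: order_trans SUP_upper)
  with assms(3) show "l \<le> (SUP x\<in>{x. P x}. f x)"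
    using assms(2) by (rule tendsto_upperbound)
qed

text \<open>The constants \<open>\<rho>\<close> and \<open>c\<close> change the logarithms only by a
  bounded amount, which vanishes in the quotient as the scales tend to 0.\<close>

lemma upper_box_dim_ge:
  fixes E :: "'a::heine_borel set" and \<epsilon> :: "nat \<Rightarrow> real"
  assumes "bounded E" "0 < \<rho>" "0 < c" "\<epsilon> \<longlonglongrightarrow> 0" "\<And>m. 0 < \<epsilon> m"
    and "\<And>m. G m \<subseteq> E" "\<And>m. separated (c * \<epsilon> m) (G m)"
    and "\<And>m. (\<rho> / \<epsilon> m) powr s \<le> real (card (G m))"
  shows "ereal s \<le> upper_box_dim E"
  unfolding upper_box_dim_def
proof (rule le_Limsup_along_filterlim)
  \<comment> \<open>The factor 1/2 puts the covering scale strictly below the separation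
    \<open>c * \<epsilon> m\<close>.\<close>
  let ?\<delta> = "\<lambda>m. c / 2 * \<epsilon> m"
  let ?L = "\<lambda>m. ln (1 / ?\<delta> m)"
  let ?h = "\<lambda>m. s * ln (\<rho> / \<epsilon> m) / ?L m"
  have "(\<lambda>m. c / 2 * \<epsilon> m) \<longlonglongrightarrow> c / 2 * 0" by (intro tendsto_intros assms)
  then show \<delta>: "filterlim ?\<delta> (at_right 0) sequentially"
    using assms(3,5) by (auto simp: filterlim_at intro!: always_eventually less_imp_neq[THEN not_sym])
  have L: "filterlim ?L at_top sequentially"
    using filterlim_compose[OF ln_at_top filterlim_compose[OF filterlim_inverse_at_top_right \<delta>]]
    by (simp add: inverse_eq_divide)
  have Lpos: "eventually (\<lambda>m. 0 < ?L m) sequentially"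
    using L by (simp add: filterlim_at_top_dense)
  \<comment> \<open>This is \<open>?h\<close> rewritten by
    \<open>ln (\<rho> / \<epsilon> m) = ?L m + ln (\<rho> * c / 2)\<close>, which is valid once
    \<open>?L m\<close> is nonzero.\<close>
  have "(\<lambda>m. s * (1 + ln (\<rho> * c / 2) / ?L m)) \<longlonglongrightarrow> s * (1 + 0)"
    by (intro tendsto_intros real_tendsto_divide_at_top[OF tendsto_const L])
  moreover have "eventually (\<lambda>m. s * (1 + ln (\<rho> * c / 2) / ?L m) = ?h m) sequentially"
    using Lpos
  proof eventually_elim
    case (elim m)
    have "ln (\<rho> / \<epsilon> m) = ?L m + ln (\<rho> * c / 2)"
      using assms(2,3) assms(5)[of m] by (simp add: ln_div ln_mult)
    then show ?case using elim by (simp add: field_simps)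
  qed
  ultimately have "?h \<longlonglongrightarrow> s" by (simp add: tendsto_cong)
  then show "(\<lambda>m. ereal (?h m)) \<longlonglongrightarrow> ereal s" by simp
  show "eventually (\<lambda>m. ereal (?h m) \<le> ereal (ln (real (covering_number (?\<delta> m) E)) / ?L m)) sequentially"
    using Lpos
  proof eventually_elim
    case (elim m)
    have "card (G m) \<le> covering_number (?\<delta> m) E"
      using assms(3) assms(5)[of m]
      by (intro card_separated_le_covering_number[OF assms(1) _ _ assms(6,7)]) auto
    then have "(\<rho> / \<epsilon> m) powr s \<le> real (covering_number (?\<delta> m) E)"
      using assms(8)[of m] by linarith
    moreover have pos: "0 < \<rho> / \<epsilon> m" using assms(2,5) by simp
    ultimately have "ln ((\<rho> / \<epsilon> m) powr s) \<le> ln (real (covering_number (?\<delta> m) E))"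
      by (intro ln_mono) auto
    then have "s * ln (\<rho> / \<epsilon> m) \<le> ln (real (covering_number (?\<delta> m) E))"
      using pos by (simp add: ln_powr)
    then show ?case using elim by (simp add: divide_right_mono)
  qed
qed simp

theorem theorem5p9:
  fixes A :: "(real ^ 'n) set" and x :: "real ^ 'n"
    and k :: nat and v :: "nat \<Rightarrow> real ^ 'n" and d :: "nat \<Rightarrow> real"
  assumes "x \<in> closure A"
    and "\<And>i. i \<in> {1..k} \<Longrightarrow> v i \<in> sphere 0 1"
    and "inj_on v {1..k}" and "independent (v ` {1..k})"
    and "\<And>i. i \<in> {1..k} \<Longrightarrow> d i \<in> {0..1}"
    and "product_grid_realization A x k v d"
  shows "pbox_dim A x \<ge> ereal (\<Sum>i=1..k. d i)"
  unfolding pbox_dim_def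
proof (rule INF_greatest)
  fix r :: real assume "r \<in> {0<..}"
  obtain C c where C: "C \<ge> 1" and c: "c > 0" and
    realize: "\<forall>\<rho>\<^sub>0>0. \<forall>\<rho>. 0 < \<rho> \<and> \<rho> < \<rho>\<^sub>0 \<longrightarrow> (\<forall>\<eta>>0.
        \<exists>(\<epsilon> :: nat \<Rightarrow> real) (P :: nat \<Rightarrow> nat \<Rightarrow> real set).
          decseq \<epsilon> \<and> \<epsilon> \<longlonglongrightarrow> 0 \<and>
          (\<forall>m. 0 < \<epsilon> m \<and> \<epsilon> m < \<rho> \<and>
               (\<forall>i\<in>{1..k}. finite (P i m) \<and> P i m \<subseteq> {-\<rho>..\<rho>} \<and>
                            real (card (P i m)) \<ge> (\<rho> / \<epsilon> m) powr (d i - \<eta>)) \<and>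
               grid x k v (\<lambda>i. P i m) \<subseteq> A \<inter> ball x (C * \<rho>) \<and>
               separated (c * \<epsilon> m) (grid x k v (\<lambda>i. P i m))))"
    using assms(6) unfolding product_grid_realization_def by (elim exE conjE) (rule that)
  \<comment> \<open>With this choice the containing ball of radius \<open>C * \<rho>\<close> is
    exactly the given \<open>ball x r\<close>.\<close>
  define \<rho> where "\<rho> = r / C"
  have \<rho>: "0 < \<rho>" "C * \<rho> = r" using C \<open>r \<in> {0<..}\<close> by (auto simp: \<rho>_def)
  \<comment> \<open>Each of the \<open>k\<close> factors loses \<open>\<eta>\<close> in its
    exponent, hence the total loss \<open>real k * \<eta>\<close>.\<close>
  have bound: "ereal ((\<Sum>i=1..k. d i) - real k * \<eta>) \<le> upper_box_dim (A \<inter> ball x r)"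
    if "\<eta> > 0" for \<eta>
  proof -
    \<comment> \<open>The value \<open>2 * \<rho>\<close> serves as \<open>\<rho>\<^sub>0\<close>;
      any number above \<open>\<rho>\<close> would do.\<close>
    have "0 < 2 * \<rho>" "0 < \<rho> \<and> \<rho> < 2 * \<rho>" using \<rho>(1) by auto
    note realize[rule_format, OF this that, unfolded \<rho>(2)]
    then obtain \<epsilon> P where lim: "\<epsilon> \<longlonglongrightarrow> 0" and
      *: "\<forall>m. 0 < \<epsilon> m \<and> \<epsilon> m < \<rho> \<and>
               (\<forall>i\<in>{1..k}. finite (P i m) \<and> P i m \<subseteq> {-\<rho>..\<rho>} \<and>
                            real (card (P i m)) \<ge> (\<rho> / \<epsilon> m) powr (d i - \<eta>)) \<and>
               grid x k v (\<lambda>i. P i m) \<subseteq> A \<inter> ball x r \<and>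
               separated (c * \<epsilon> m) (grid x k v (\<lambda>i. P i m))"
      by (elim exE conjE) (rule that)
    have pos: "0 < \<epsilon> m"
      and card: "\<And>i. i \<in> {1..k} \<Longrightarrow> (\<rho> / \<epsilon> m) powr (d i - \<eta>) \<le> real (card (P i m))"
      and sub: "grid x k v (\<lambda>i. P i m) \<subseteq> A \<inter> ball x r"
      and sep: "separated (c * \<epsilon> m) (grid x k v (\<lambda>i. P i m))" for m
      using *[rule_format, of m] by blast+
    show ?thesis
    proof (rule upper_box_dim_ge[OF _ \<rho>(1) c lim pos sub sep])
      show "bounded (A \<inter> ball x r)" by (simp add: bounded_Int)
      fix m
      have "(\<rho> / \<epsilon> m) powr ((\<Sum>i=1..k. d i) - real k * \<eta>)
          = (\<rho> / \<epsilon> m) powr (\<Sum>i=1..k. d i - \<eta>)"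
        by (simp add: sum_subtractf)
      also have "\<dots> = (\<Prod>i=1..k. (\<rho> / \<epsilon> m) powr (d i - \<eta>))"
        using \<rho>(1) pos[of m] by (intro powr_sum) auto
      also have "\<dots> \<le> (\<Prod>i=1..k. real (card (P i m)))"
        using card by (intro prod_mono) auto
      also have "\<dots> = real (card (grid x k v (\<lambda>i. P i m)))"
        by (simp add: card_grid[OF assms(3,4)])
      finally show "(\<rho> / \<epsilon> m) powr ((\<Sum>i=1..k. d i) - real k * \<eta>)
          \<le> real (card (grid x k v (\<lambda>i. P i m)))" .
    qed
  qed
  \<comment> \<open>The radius \<open>r\<close> is fixed and the right side of \<open>bound\<close>
    is free of \<open>\<eta>\<close>, so \<open>\<eta>\<close> can tend to 0 from the right.\<close>
  have "((\<lambda>\<eta>. (\<Sum>i=1..k. d i) - real k * \<eta>) \<longlongrightarrow> (\<Sum>i=1..k. d i) - real k * 0) (at_right 0)"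
    by (intro tendsto_intros)
  then have "((\<lambda>\<eta>. ereal ((\<Sum>i=1..k. d i) - real k * \<eta>)) \<longlongrightarrow> ereal (\<Sum>i=1..k. d i)) (at_right 0)"
    by simp
  then show "ereal (\<Sum>i=1..k. d i) \<le> upper_box_dim (A \<inter> ball x r)"
    by (rule tendsto_upperbound)
      (use bound in \<open>auto intro!: eventually_at_rightI[of 0 1]\<close>)
qed

end
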